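(* The following statement (Mullen's conjecture) is false: "If $n$ is even, $q$ is an odd prime power with $q>n(n-2)$, and $f\in\mathbb{F}_q[x]$ has degree $n$, then $|V_f|\leq q-\lceil (q-1)/n\rceil$." Specifically, for $n=6$ and $q=27$ one has $q>n(n-2)=24$, and for every nonzero $a\in\mathbb{F}_{3^3}$ the polynomial $f(x)=x^6+ax^5-a^4x^2\in\mathbb{F}_{3^3}[x]$ is a permutation polynomial of $\mathbb{F}_{3^3}$, so that $|V_f|=27>22=q-\lceil (q-1)/n\rceil$.
   Context: $\mathbb{F}_q$ is the finite field with $q$ elements. For $f\in\mathbb{F}_q[x]$, the value set is $V_f=\{f(c): c\in\mathbb{F}_q\}$. A polynomial $f\in\mathbb{F}_q[x]$ is a permutation polynomial of $\mathbb{F}_q$ if the function $c\mapsto f(c)$ is a permutation of $\mathbb{F}_q$. *)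

theory Defs
  imports "HOL-Number_Theory.Prime_Powers" "HOL-Algebra.UnivPoly"
begin

definition value_set :: "('a, 'b) ring_scheme \<Rightarrow> (nat \<Rightarrow> 'a) \<Rightarrow> 'a set" where
  "value_set F f = (\<lambda>c. eval F F id c f) ` carrier F"

definition permutation_polynomial :: "('a, 'b) ring_scheme \<Rightarrow> (nat \<Rightarrow> 'a) \<Rightarrow> bool" where
  "permutation_polynomial F f \<longleftrightarrow>
     f \<in> carrier (UP F) \<and> bij_betw (\<lambda>c. eval F F id c f) (carrier F) (carrier F)"

(* Stated over fields whose carrier is a set of natural numbers; every finite field is isomorphic
   to one of these, and refuting this instance refutes the conjecture over any larger class.
   Positivity of n is explicit because the bound divides by n. The bound q - ceiling((q-1)/n) is
   taken in int, and n(n-2) < q as well, so that nothing is truncated. *)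
definition mullen_conjecture :: bool where
  "mullen_conjecture \<longleftrightarrow>
     (\<forall>(n::nat) (q::nat) (F :: nat ring) f.
        n > 0 \<longrightarrow> even n \<longrightarrow> primepow q \<longrightarrow> odd q \<longrightarrow> int q > int n * (int n - 2) \<longrightarrow>
        field F \<longrightarrow> card (carrier F) = q \<longrightarrow>
        f \<in> carrier (UP F) \<longrightarrow> deg F f = n \<longrightarrow>
        int (card (value_set F f)) \<le> int q - \<lceil>(real q - 1) / real n\<rceil>)"

end

(* Since f(a y) = a^6 g(y) with g(y) = y^6 + y^5 - y^2, it suffices that g permutes the field.
   Its inverse is again given by a polynomial h over the prime field. The identity h(g(x)) = x
   follows from 3 = 0 and x^27 = x alone; writing g(x), g(x)^3 and g(x)^9 in terms of x, x^3 and
   x^9 keeps all degrees small. *)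

theory Submission
  imports Defs "HOL-Algebra.Weak_Morphisms" "HOL-Algebra.Multiplicative_Group"
    "HOL-Decision_Procs.Commutative_Ring" "HOL-Library.Numeral_Type"
begin

section \<open>Reflective verification of the inverse polynomial\<close>

text \<open>The variables stand for \<open>x\<close>, \<open>x\<^sup>3\<close> and \<open>x\<^sup>9\<close>, which the cubing map permutes cyclically when
  \<open>x\<^sup>2\<^sup>7 = x\<close>.\<close>

definition frob_reduce :: "polex \<Rightarrow> pol" where
  "frob_reduce P = pnsubstl (norm P) (mk_monpol_list
     [(Pow (Var 0) 3, Var 1), (Pow (Var 1) 3, Var 2), (Pow (Var 2) 3, Var 0), (Const 3, Const 0)])
     100 100"

text \<open>With \<open>y = x\<^sup>3\<close> this is \<open>x\<^sup>6 + x\<^sup>5 - x\<^sup>2\<close>.\<close>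

definition sextic_polex :: "polex \<Rightarrow> polex \<Rightarrow> polex" where
  "sextic_polex x y = Sub (Add (Pow y 2) (Mul y (Pow x 2))) (Pow x 2)"

text \<open>With \<open>d = c\<^sup>3\<close> and \<open>e = c\<^sup>9\<close> this is the polynomial of degree at most 26 that Lagrange
  interpolation yields for the inverse permutation; the exponents of \<open>c\<close> are split into their
  base-3 digits.\<close>

definition inverse_polex :: "polex \<Rightarrow> polex \<Rightarrow> polex \<Rightarrow> polex" where
  "inverse_polex c d e = foldr Add
     [c, e, Mul c d, Mul c e, Mul d e, Mul (Pow c 2) d, Mul (Pow c 2) e, Mul c (Pow d 2), Pow e 2,
      Mul (Mul c d) e, Mul (Mul c (Pow d 2)) e]
     (Neg (foldr Add [Pow d 2, Mul (Mul (Pow c 2) d) e, Mul (Pow d 2) e] (Mul d (Pow e 2))))"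

text \<open>Cubing is additive in characteristic 3, so it merely shifts the variables
  cyclically.\<close>

lemma frob_reduce_sextic_cube:
  "frob_reduce (Pow (sextic_polex (Var 0) (Var 1)) 3) = frob_reduce (sextic_polex (Var 1) (Var 2))"
  "frob_reduce (Pow (sextic_polex (Var 1) (Var 2)) 3) = frob_reduce (sextic_polex (Var 2) (Var 0))"
  by code_simp+

lemma frob_reduce_inverse:
  "frob_reduce (inverse_polex (sextic_polex (Var 0) (Var 1)) (sextic_polex (Var 1) (Var 2))
     (sextic_polex (Var 2) (Var 0))) = frob_reduce (Var 0)"
  by code_simp

text \<open>Soundness of the rewriting: at \<open>x\<close>, \<open>x^3\<close>, \<open>x^9\<close>
  every rule is a true equation, the one for \<open>Pow (Var 2) 3\<close> by \<open>x^27 = x\<close>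
  and the one for \<open>Const 3\<close> by characteristic 3. The two values 100 cap the number of
  rewriting passes.\<close>

lemma (in cring) frob_reduce_eqD:
  assumes "frob_reduce P = frob_reduce Q" and "\<guillemotleft>3\<guillemotright> = \<zero>" and "x \<in> carrier R"
    and "x [^] (27::nat) = x"
  shows "Ipolex [x, x [^] (3::nat), x [^] (9::nat)] P = Ipolex [x, x [^] (3::nat), x [^] (9::nat)] Q"
proof -
  let ?l = "[x, x [^] (3::nat), x [^] (9::nat)]"
  have "in_carrier ?l"
    using assms by (simp add: in_carrier_def)
  moreover have "Ipolex_polex_list ?l
     [(Pow (Var 0) 3, Var 1), (Pow (Var 1) 3, Var 2), (Pow (Var 2) 3, Var 0), (Const 3, Const 0)]"
    using assms by (simp add: nat_pow_pow)
  ultimately show ?thesis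
    using assms(1) norm_subst_correct unfolding frob_reduce_def by metis
qed

text \<open>Expressing \<open>x\<close> through \<open>c\<close> alone makes equal values force
  equal arguments.\<close>

lemma (in cring) sextic_inverse:
  assumes "\<guillemotleft>3\<guillemotright> = \<zero>" and x: "x \<in> carrier R" and "x [^] (27::nat) = x"
    and c: "c = x [^] (6::nat) \<oplus> x [^] (5::nat) \<ominus> x [^] (2::nat)"
  shows "x = Ipolex [c, c [^] (3::nat), c [^] (9::nat)] (inverse_polex (Var 0) (Var 1) (Var 2))"
proof -
  let ?l = "[x, x [^] (3::nat), x [^] (9::nat)]"
  note reduce = frob_reduce_eqD[OF _ assms(1-3)]
  have 0: "Ipolex ?l (sextic_polex (Var 0) (Var 1)) = c"
    using x by (simp add: sextic_polex_def c nat_pow_pow nat_pow_mult)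
  have 1: "Ipolex ?l (sextic_polex (Var 1) (Var 2)) = c [^] (3::nat)"
    using reduce[OF frob_reduce_sextic_cube(1)] 0 by simp
  have 2: "Ipolex ?l (sextic_polex (Var 2) (Var 0)) = c [^] (9::nat)"
    using reduce[OF frob_reduce_sextic_cube(2)] 1 x by (simp add: nat_pow_pow c)
  have "x = Ipolex ?l (Var 0)"
    by simp
  also have "\<dots> = Ipolex ?l (inverse_polex (sextic_polex (Var 0) (Var 1)) (sextic_polex (Var 1) (Var 2))
      (sextic_polex (Var 2) (Var 0)))"
    using reduce[OF frob_reduce_inverse] by simp
  \<comment> \<open>Evaluation commutes with substitution, and \<open>0\<close>, \<open>1\<close>,
    \<open>2\<close> give the values of the substituted expressions.\<close>
  also have "\<dots> = Ipolex [c, c [^] (3::nat), c [^] (9::nat)] (inverse_polex (Var 0) (Var 1) (Var 2))"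
    by (simp add: inverse_polex_def 0 1 2 del: One_nat_def) simp
  finally show ?thesis .
qed

section \<open>Arithmetic in fields with 27 elements\<close>

text \<open>The order 27 of the additive group annihilates one; 27 is a power of 3 and there are no
  zero divisors.\<close>

lemma (in field) of_int_3_eq_zero:
  assumes "card (carrier R) = 27"
  shows "\<guillemotleft>3\<guillemotright> = \<zero>"
proof -
  have *: "\<guillemotleft>n\<guillemotright>\<^sub>\<nat> = [n] \<cdot> \<one>" for n :: nat
    by (induct n) (simp_all add: add.nat_pow_Suc a_comm)
  have "\<guillemotleft>27\<guillemotright> = [(27::nat)] \<cdot> \<one>"
    by (simp add: of_integer_def *)
  also have "\<dots> = \<zero>"
    using add.pow_order_eq_1[of \<one>] assms by (simp add: order_def)
  finally have "\<guillemotleft>3 * (3 * 3)\<guillemotright> = \<zero>"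
    by simp
  then show ?thesis
    by (metis integral of_int_closed of_int_mult m_closed)
qed

text \<open>Lagrange's theorem in the unit group handles nonzero \<open>x\<close>; for zero the
  exponent is positive.\<close>

lemma (in field) pow_card_carrier:
  assumes "finite (carrier R)" and x: "x \<in> carrier R"
  shows "x [^] card (carrier R) = x"
proof (cases "x = \<zero>")
  case True
  then show ?thesis
    using assms by (metis card_gt_0_iff empty_iff nat_pow_zero neq0_conv)
next
  case False
  have card: "card (carrier R) = Suc (card (Units R))"
    using assms card_Suc_Diff1[of "carrier R" \<zero>] by (simp add: field_Units)
  then show ?thesis
    using units_power_order_eq_one[of x] False assms unfolding card by (simp add: field_Units)
qed

lemma (in field) sextic_inj:
  assumes "card (carrier R) = 27" and "x \<in> carrier R" "y \<in> carrier R"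
    and "x [^] (6::nat) \<oplus> x [^] (5::nat) \<ominus> x [^] (2::nat)
       = y [^] (6::nat) \<oplus> y [^] (5::nat) \<ominus> y [^] (2::nat)"
  shows "x = y"
proof -
  have "finite (carrier R)"
    using assms(1) by (metis card.infinite zero_neq_numeral)
  then have 27: "x [^] (27::nat) = x" "y [^] (27::nat) = y"
    using pow_card_carrier[of x] pow_card_carrier[of y] assms(1-3) by simp_all
  note inverse = sextic_inverse[OF of_int_3_eq_zero[OF assms(1)]]
  show ?thesis
    using inverse[OF assms(2) 27(1) refl] inverse[OF assms(3) 27(2) refl] unfolding assms(4)
    by (rule trans[OF _ sym])
qed

section \<open>The sextic and its permutation property\<close>

definition sextic :: "('a, 'b) ring_scheme \<Rightarrow> 'a \<Rightarrow> nat \<Rightarrow> 'a" where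
  "sextic F a = monom (UP F) \<one>\<^bsub>F\<^esub> 6 \<oplus>\<^bsub>UP F\<^esub> monom (UP F) a 5
     \<ominus>\<^bsub>UP F\<^esub> monom (UP F) (a [^]\<^bsub>F\<^esub> (4::nat)) 2"

lemma sextic_closed:
  assumes "cring F" and "a \<in> carrier F"
  shows "sextic F a \<in> carrier (UP F)"
proof -
  interpret UP_cring F "UP F"
    using assms by (simp add: UP_cring_def)
  show ?thesis
    using assms(2) by (simp add: sextic_def)
qed

lemma deg_sextic:
  assumes "field F" and "a \<in> carrier F"
  shows "deg F (sextic F a) = 6"
proof -
  interpret field F by fact
  interpret U: UP_cring F "UP F"
    using is_cring by (simp add: UP_cring_def)
  show ?thesis
    using assms(2) sextic_closed[OF is_cring assms(2)]
    by (intro antisym U.deg_aboveI U.deg_belowI) (simp_all add: sextic_def U.P.minus_eq minus_eq)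
qed

lemma eval_sextic:
  assumes "cring F" and a: "a \<in> carrier F" and x: "x \<in> carrier F"
  shows "eval F F id x (sextic F a) =
    x [^]\<^bsub>F\<^esub> (6::nat) \<oplus>\<^bsub>F\<^esub> a \<otimes>\<^bsub>F\<^esub> x [^]\<^bsub>F\<^esub> (5::nat) \<ominus>\<^bsub>F\<^esub> a [^]\<^bsub>F\<^esub> (4::nat) \<otimes>\<^bsub>F\<^esub> x [^]\<^bsub>F\<^esub> (2::nat)"
proof -
  interpret cring F by fact
  interpret U: UP_pre_univ_prop F F id "UP F"
    by unfold_locales simp_all
  interpret E: ring_hom_cring "UP F" F "eval F F id x"
    by unfold_locales (rule U.eval_ring_hom[OF x])
  show ?thesis
    using a x by (simp add: sextic_def U.P.minus_eq minus_eq U.eval_monom)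
qed

lemma permutation_polynomial_sextic:
  assumes "field F" and card: "card (carrier F) = 27" and a: "a \<in> carrier F" "a \<noteq> \<zero>\<^bsub>F\<^esub>"
  shows "permutation_polynomial F (sextic F a)"
proof -
  interpret field F by fact
  let ?f = "\<lambda>x. eval F F id x (sextic F a)"
  have finite: "finite (carrier F)"
    using card by (metis card.infinite zero_neq_numeral)
  have unit: "a \<in> Units F"
    using a field_Units by simp
  define g where "g y = y [^]\<^bsub>F\<^esub> (6::nat) \<oplus>\<^bsub>F\<^esub> y [^]\<^bsub>F\<^esub> (5::nat) \<ominus>\<^bsub>F\<^esub> y [^]\<^bsub>F\<^esub> (2::nat)" for y
  have homogeneous: "?f x = a [^]\<^bsub>F\<^esub> (6::nat) \<otimes>\<^bsub>F\<^esub> g (inv\<^bsub>F\<^esub> a \<otimes>\<^bsub>F\<^esub> x)" if x: "x \<in> carrier F" for x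
  proof -
    define y where "y = inv\<^bsub>F\<^esub> a \<otimes>\<^bsub>F\<^esub> x"
    have y: "y \<in> carrier F" "x = a \<otimes>\<^bsub>F\<^esub> y"
      using unit a x by (simp_all add: y_def m_assoc[symmetric])
    \<comment> \<open>After \<open>x = a y\<close> the factor \<open>a^6\<close> splits off in any
      commutative ring, so comparing normal forms proves the identity.\<close>
    let ?x = "Mul (Var 0) (Var 1)"
    have "in_carrier [a, y]"
      using a y by (simp add: in_carrier_def)
    then have "Ipolex [a, y] (Sub (Add (Pow ?x 6) (Mul (Var 0) (Pow ?x 5))) (Mul (Pow (Var 0) 4) (Pow ?x 2)))
       = Ipolex [a, y] (Mul (Pow (Var 0) 6) (Sub (Add (Pow (Var 1) 6) (Pow (Var 1) 5)) (Pow (Var 1) 2)))"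
      by (rule norm_eq) code_simp
    then show ?thesis
      unfolding y_def[symmetric] using a y by (simp add: eval_sextic[OF is_cring] g_def)
  qed
  have "inj_on ?f (carrier F)"
  proof (rule inj_onI)
    fix x y assume *: "x \<in> carrier F" "y \<in> carrier F" "?f x = ?f y"
    have "g (inv\<^bsub>F\<^esub> a \<otimes>\<^bsub>F\<^esub> x) = g (inv\<^bsub>F\<^esub> a \<otimes>\<^bsub>F\<^esub> y)"
      using * unit Units_pow_closed[OF unit, of 6]
      by (simp add: homogeneous Units_l_cancel g_def)
    then have "inv\<^bsub>F\<^esub> a \<otimes>\<^bsub>F\<^esub> x = inv\<^bsub>F\<^esub> a \<otimes>\<^bsub>F\<^esub> y"
      using *(1,2) unit unfolding g_def by (blast intro: sextic_inj[OF card] m_closed Units_inv_closed)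
    then show "x = y"
      using * unit by (metis Units_inv_Units Units_l_cancel)
  qed
  moreover have "?f ` carrier F \<subseteq> carrier F"
    using a by (auto simp: eval_sextic is_cring)
  ultimately have "bij_betw ?f (carrier F) (carrier F)"
    by (simp add: bij_betw_def endo_inj_surj finite)
  then show ?thesis
    by (simp add: permutation_polynomial_def sextic_closed is_cring a)
qed

section \<open>A concrete field with 27 elements\<close>

text \<open>The triple \<open>(a, b, c)\<close> stands for \<open>a + b t + c t\<^sup>2\<close> with \<open>t\<^sup>3 = t + 1\<close>.\<close>

definition F27 :: "(3 \<times> 3 \<times> 3) ring" where
  "F27 = \<lparr>carrier = UNIV,
     mult = \<lambda>(a, b, c) (a', b', c').
       (a * a' + (b * c' + c * b'),
        a * b' + b * a' + (b * c' + c * b') + c * c',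
        a * c' + b * b' + c * a' + c * c'),
     one = (1, 0, 0),
     zero = (0, 0, 0),
     add = \<lambda>(a, b, c) (a', b', c'). (a + a', b + b', c + c')\<rparr>"

lemma cring_F27: "cring F27"
proof (rule cringI)
  show "abelian_group F27"
    by (rule abelian_groupI)
      (auto simp: F27_def add.assoc add.commute intro: exI[of _ "- x" for x] add.left_inverse)
  show "Group.comm_monoid F27"
    by (rule comm_monoidI) (auto simp: F27_def algebra_simps)
qed (auto simp: F27_def algebra_simps)

text \<open>Lets \<open>simp\<close> settle statements over the three-element field by
  enumeration.\<close>

lemma forall_type_3: "(\<forall>x::3. P x) \<longleftrightarrow> P 0 \<and> P 1 \<and> P 2"
proof -
  have "x = 0 \<or> x = 1 \<or> x = 2" for x :: 3
  proof (cases x)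
    case (of_int z)
    then have "z = 0 \<or> z = 1 \<or> z = 2"
      by auto
    then show ?thesis
      using of_int by auto
  qed
  then show ?thesis
    by metis
qed

lemma numeral_type_3: "(3::3) = 0" "(4::3) = 1"
  by simp_all

text \<open>The determinant of multiplication by \<open>(a, b, c)\<close>, expanded along the first row. The cofactors
  of that row give the inverse of \<open>(a, b, c)\<close> up to this factor.\<close>

definition norm_F27 :: "3 \<Rightarrow> 3 \<Rightarrow> 3 \<Rightarrow> 3" where
  "norm_F27 a b c = a * ((a + c) * (a + c) - b * (b + c)) + c * (c * (b + c) - b * (a + c)) + b * (b * b - c * (a + c))"

text \<open>A nonzero triple has norm 1 or -1, reflecting the irreducibility of
  \<open>t^3 - t - 1\<close>; all triples are checked.\<close>

lemma norm_F27_square: "(a, b, c) \<noteq> (0, 0, 0) \<longrightarrow> norm_F27 a b c * norm_F27 a b c = 1"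
proof -
  have "\<forall>a b c. (a, b, c) \<noteq> (0, 0, 0) \<longrightarrow> norm_F27 a b c * norm_F27 a b c = 1"
    unfolding forall_type_3 norm_F27_def by (simp add: numeral_type_3)
  then show ?thesis
    by blast
qed

lemma field_F27: "field F27"
proof -
  interpret cring F27
    by (rule cring_F27)
  show ?thesis
  proof (rule cring_fieldI2)
    show "\<zero>\<^bsub>F27\<^esub> \<noteq> \<one>\<^bsub>F27\<^esub>"
      by (simp add: F27_def)
  next
    fix x assume x: "x \<noteq> \<zero>\<^bsub>F27\<^esub>"
    obtain a b c where abc: "x = (a, b, c)"
      by (metis surj_pair)
    \<comment> \<open>Since \<open>N * N = 1\<close>, multiplying the cofactors by \<open>N\<close>
      amounts to dividing them by the determinant.\<close>
    define N where "N = norm_F27 a b c"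
    have "N * N = 1"
      using norm_F27_square x by (simp add: N_def F27_def abc)
    moreover have "x \<otimes>\<^bsub>F27\<^esub> (N * ((a + c) * (a + c) - b * (b + c)), N * (c * (b + c) - b * (a + c)),
        N * (b * b - c * (a + c))) = (N * norm_F27 a b c, 0, 0)"
      by (simp add: F27_def abc norm_F27_def algebra_simps)
    ultimately have "x \<otimes>\<^bsub>F27\<^esub> (N * ((a + c) * (a + c) - b * (b + c)), N * (c * (b + c) - b * (a + c)),
        N * (b * b - c * (a + c))) = \<one>\<^bsub>F27\<^esub>"
      by (simp add: N_def F27_def)
    then show "\<exists>y\<in>carrier F27. x \<otimes>\<^bsub>F27\<^esub> y = \<one>\<^bsub>F27\<^esub>"
      by (auto simp: F27_def)
  qed
qed

text \<open>\<open>mullen_conjecture\<close> ranges over \<open>nat ring\<close>, so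
  \<open>F27\<close> is transported along an injection.\<close>

lemma exists_field_card_27: "\<exists>F :: nat ring. field F \<and> card (carrier F) = 27"
proof -
  obtain f :: "3 \<times> 3 \<times> 3 \<Rightarrow> nat" where f: "inj f"
    using finite_imp_inj_to_nat_seg[OF finite] by blast
  then have "inj_on f (carrier F27)"
    by (rule inj_on_subset) simp
  then have "field (image_ring f F27)"
    by (rule field.inj_imp_image_ring_is_field[OF field_F27])
  moreover have "card (carrier (image_ring f F27)) = 27"
    using f by (simp add: image_ring_carrier F27_def card_image)
  ultimately show ?thesis
    by blast
qed

section \<open>Refutation of the conjecture\<close>

lemma sextic_over_field_27:
  fixes F :: "'a ring"
  assumes F: "field F" "card (carrier F) = 27" and a: "a \<in> carrier F" "a \<noteq> \<zero>\<^bsub>F\<^esub>"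
  shows "sextic F a \<in> carrier (UP F) \<and> deg F (sextic F a) = 6 \<and>
    permutation_polynomial F (sextic F a) \<and> card (value_set F (sextic F a)) = 27"
proof -
  interpret field F by (fact F(1))
  show ?thesis
    using sextic_closed[OF is_cring a(1)] deg_sextic[OF F(1) a(1)]
      permutation_polynomial_sextic[OF F a] F(2)
    by (simp add: permutation_polynomial_def value_set_def bij_betw_def)
qed

theorem mainTheorem2:
  "\<not> mullen_conjecture \<and>
   (27::int) > 6 * (6 - 2) \<and> (6::int) * (6 - 2) = 24 \<and>
   (\<exists>F :: nat ring. field F \<and> card (carrier F) = 27) \<and>
   (\<forall>F :: 'a ring. field F \<and> card (carrier F) = 27 \<longrightarrow>
      (\<forall>a \<in> carrier F - {\<zero>\<^bsub>F\<^esub>}.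
         let f = monom (UP F) \<one>\<^bsub>F\<^esub> 6
                   \<oplus>\<^bsub>UP F\<^esub> monom (UP F) a 5
                   \<ominus>\<^bsub>UP F\<^esub> monom (UP F) (a [^]\<^bsub>F\<^esub> (4::nat)) 2
         in f \<in> carrier (UP F) \<and> deg F f = 6 \<and>
            permutation_polynomial F f \<and>
            card (value_set F f) = 27 \<and>
            int (card (value_set F f)) > 22 \<and>
            (22::int) = 27 - \<lceil>(27 - 1) / (6::real)\<rceil>))"
proof -
  \<comment> \<open>For \<open>q = 27\<close> and \<open>n = 6\<close> the conjectured bound is thus
    27 - 5 = 22.\<close>
  have ceiling: "\<lceil>26 / (6::real)\<rceil> = 5"
    by (simp add: ceiling_eq_iff)
  have "\<not> mullen_conjecture"
  proof
    assume conjecture: mullen_conjecture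
    obtain F :: "nat ring" where F: "field F" "card (carrier F) = 27"
      using exists_field_card_27 by blast
    let ?f = "sextic F \<one>\<^bsub>F\<^esub>"
    have "\<one>\<^bsub>F\<^esub> \<in> carrier F" "\<one>\<^bsub>F\<^esub> \<noteq> \<zero>\<^bsub>F\<^esub>"
      using F(1) by (simp_all add: field_def domain_def domain_axioms_def cring_def ring.ring_simprules)
    note f = sextic_over_field_27[OF F this]
    have "primepow (27::nat)"
      using primepow_prime_power[of "3::nat" 3] by simp
    then have "int (card (value_set F ?f)) \<le> int 27 - \<lceil>(real 27 - 1) / real 6\<rceil>"
      using conjecture F f unfolding mullen_conjecture_def
      by (elim allE[of _ 6] allE[of _ 27] allE[of _ F] allE[of _ ?f]) simp
    then show False
      using f ceiling by simp
  qed
  then show ?thesis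
    using exists_field_card_27 ceiling unfolding Let_def sextic_def[symmetric]
    by (auto simp: sextic_over_field_27)
qed

end
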